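(* Let $p:\mathbf{N}_0\to(0,\infty)$ be a sequence of strictly positive real numbers and let $q:\mathbf{N}_0\to[0,\infty)$ be a sequence of non-negative real numbers that is not identically zero. Let $$\mathcal{H}_1=\Big\{u\in\mathbf{C}^{\mathbf{N}_0}:\ \sum_{n=0}^\infty \big(p(n)|(\Delta u)(n)|^2+q(n)|u(n)|^2\big)<\infty\Big\},$$ equipped with the scalar product $$\langle u,v\rangle=\sum_{n=0}^\infty \big(p(n)(\Delta u)(n)\overline{(\Delta v)(n)}+q(n)u(n)\overline{v(n)}\big)$$ and the associated norm $\|u\|_{\mathcal{H}_1}=\langle u,u\rangle^{1/2}$. Then the space $\mathcal{H}_1$ is complete.
   Context: $\mathbf{N}=\{1,2,3,\dots\}$ and $\mathbf{N}_0=\{0,1,2,\dots\}$; $\mathbf{C}^{\mathbf{N}_0}$ is the set of all complex-valued sequences indexed by $\mathbf{N}_0$. The forward difference operator is $(\Delta u)(n)=u(n+1)-u(n)$. *)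

theory Defs
  imports "HOL-Analysis.Analysis"
begin

definition fwd_diff :: "(nat \<Rightarrow> complex) \<Rightarrow> nat \<Rightarrow> complex" where
  "fwd_diff u n = u (n + 1) - u n"

definition H1 :: "(nat \<Rightarrow> real) \<Rightarrow> (nat \<Rightarrow> real) \<Rightarrow> (nat \<Rightarrow> complex) set" where
  "H1 p q = {u. summable (\<lambda>n. p n * (cmod (fwd_diff u n))\<^sup>2 + q n * (cmod (u n))\<^sup>2)}"

definition H1_inner ::
  "(nat \<Rightarrow> real) \<Rightarrow> (nat \<Rightarrow> real) \<Rightarrow> (nat \<Rightarrow> complex) \<Rightarrow> (nat \<Rightarrow> complex) \<Rightarrow> complex" where
  "H1_inner p q u v =
     (\<Sum>n. of_real (p n) * fwd_diff u n * cnj (fwd_diff v n) + of_real (q n) * u n * cnj (v n))"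

(* The inner product of u with itself is a non-negative real on H1 (H1_inner_self), so taking its
   modulus changes nothing there; the modulus makes the root real and non-negative for all u. *)
definition H1_norm :: "(nat \<Rightarrow> real) \<Rightarrow> (nat \<Rightarrow> real) \<Rightarrow> (nat \<Rightarrow> complex) \<Rightarrow> real" where
  "H1_norm p q u = sqrt (cmod (H1_inner p q u u))"

definition H1_dist ::
  "(nat \<Rightarrow> real) \<Rightarrow> (nat \<Rightarrow> real) \<Rightarrow> (nat \<Rightarrow> complex) \<Rightarrow> (nat \<Rightarrow> complex) \<Rightarrow> real" where
  "H1_dist p q u v = H1_norm p q (\<lambda>n. u n - v n)"

definition H1_term :: "(nat \<Rightarrow> real) \<Rightarrow> (nat \<Rightarrow> real) \<Rightarrow> (nat \<Rightarrow> complex) \<Rightarrow> nat \<Rightarrow> real" where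
  "H1_term p q u n = p n * (cmod (fwd_diff u n))\<^sup>2 + q n * (cmod (u n))\<^sup>2"

lemma mem_H1_iff: "u \<in> H1 p q \<longleftrightarrow> summable (H1_term p q u)"
  by (simp add: H1_def H1_term_def[abs_def])

lemma H1_term_nonneg: "(\<And>n. 0 < p n) \<Longrightarrow> (\<And>n. 0 \<le> q n) \<Longrightarrow> 0 \<le> H1_term p q u n"
  by (simp add: H1_term_def less_imp_le)

lemma H1_inner_sums:
  fixes p q :: "nat \<Rightarrow> real"
  assumes p: "\<And>n. 0 < p n" and q: "\<And>n. 0 \<le> q n" and u: "u \<in> H1 p q" and v: "v \<in> H1 p q"
  shows "(\<lambda>n. of_real (p n) * fwd_diff u n * cnj (fwd_diff v n) + of_real (q n) * u n * cnj (v n))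
           sums H1_inner p q u v"
proof -
  have am: "c * x * y \<le> c * x\<^sup>2 + c * y\<^sup>2" if "0 \<le> c" for c x y :: real
  proof -
    have "0 \<le> c * ((x - y)\<^sup>2 + x\<^sup>2 + y\<^sup>2)" using that by simp
    then show ?thesis by (simp add: power2_eq_square algebra_simps)
  qed
  have "norm (of_real (p n) * fwd_diff u n * cnj (fwd_diff v n) + of_real (q n) * u n * cnj (v n))
          \<le> H1_term p q u n + H1_term p q v n" for n
  proof -
    have "norm (of_real (p n) * fwd_diff u n * cnj (fwd_diff v n) + of_real (q n) * u n * cnj (v n))
       \<le> p n * cmod (fwd_diff u n) * cmod (fwd_diff v n) + q n * cmod (u n) * cmod (v n)"
      using p[of n] q[of n]
      by (intro order_trans[OF norm_triangle_ineq]) (simp add: norm_mult)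
    then show ?thesis
      using am[of "p n" "cmod (fwd_diff u n)" "cmod (fwd_diff v n)"] am[of "q n" "cmod (u n)" "cmod (v n)"]
        p[of n] q[of n]
      unfolding H1_term_def by linarith
  qed
  then have "summable (\<lambda>n. of_real (p n) * fwd_diff u n * cnj (fwd_diff v n)
               + of_real (q n) * u n * cnj (v n))"
    by (rule summable_comparison_test'[OF summable_add[OF u[unfolded mem_H1_iff] v[unfolded mem_H1_iff]]])
  then show ?thesis
    unfolding H1_inner_def by (rule summable_sums)
qed

lemma H1_inner_commute:
  fixes p q :: "nat \<Rightarrow> real"
  assumes "\<And>n. 0 < p n" "\<And>n. 0 \<le> q n" "u \<in> H1 p q" "v \<in> H1 p q"
  shows "H1_inner p q u v = cnj (H1_inner p q v u)"
proof -
  have "(\<lambda>n. cnj (of_real (p n) * fwd_diff v n * cnj (fwd_diff u n) + of_real (q n) * v n * cnj (u n)))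
           sums cnj (H1_inner p q v u)"
    using H1_inner_sums[of p q v u] assms by (simp only: sums_cnj)
  then have "(\<lambda>n. of_real (p n) * fwd_diff u n * cnj (fwd_diff v n) + of_real (q n) * u n * cnj (v n))
           sums cnj (H1_inner p q v u)"
    by (simp add: mult_ac)
  then show ?thesis
    using H1_inner_sums[of p q u v] assms sums_unique2 by blast
qed

lemma H1_term_sqrt:
  assumes "\<And>n. 0 < p n" "\<And>n. 0 \<le> q n"
  shows "sqrt (H1_term p q u n) =
    sqrt ((sqrt (p n) * cmod (fwd_diff u n))\<^sup>2 + (sqrt (q n) * cmod (u n))\<^sup>2)"
  using assms by (simp add: H1_term_def power_mult_distrib less_imp_le)

lemma H1_term_add:
  assumes p: "\<And>n. 0 < p n" and q: "\<And>n. 0 \<le> q n"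
  shows "sqrt (H1_term p q (\<lambda>n. u n + v n) n) \<le> sqrt (H1_term p q u n) + sqrt (H1_term p q v n)"
proof -
  let ?a = "\<lambda>u. sqrt (p n) * cmod (fwd_diff u n)" and ?b = "\<lambda>u. sqrt (q n) * cmod (u n)"
  have d: "fwd_diff (\<lambda>n. u n + v n) n = fwd_diff u n + fwd_diff v n"
    by (simp add: fwd_diff_def)
  have "?a (\<lambda>n. u n + v n) \<le> ?a u + ?a v" "?b (\<lambda>n. u n + v n) \<le> ?b u + ?b v"
    unfolding d distrib_left[symmetric] using p[of n] q[of n]
    by (intro mult_left_mono norm_triangle_ineq; simp)+
  then have "sqrt ((?a (\<lambda>n. u n + v n))\<^sup>2 + (?b (\<lambda>n. u n + v n))\<^sup>2)
      \<le> sqrt ((?a u + ?a v)\<^sup>2 + (?b u + ?b v)\<^sup>2)"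
    using p[of n] q[of n] by (intro real_sqrt_le_mono add_mono power_mono) auto
  also have "\<dots> \<le> sqrt ((?a u)\<^sup>2 + (?b u)\<^sup>2) + sqrt ((?a v)\<^sup>2 + (?b v)\<^sup>2)"
    by (rule real_sqrt_sum_squares_triangle_ineq)
  finally show ?thesis
    by (simp only: H1_term_sqrt[OF p q])
qed

lemma H1_partial_add:
  assumes p: "\<And>n. 0 < p n" and q: "\<And>n. 0 \<le> q n" and u: "u \<in> H1 p q" and v: "v \<in> H1 p q"
  shows "(\<Sum>n<N. H1_term p q (\<lambda>n. u n + v n) n) \<le>
    (sqrt (suminf (H1_term p q u)) + sqrt (suminf (H1_term p q v)))\<^sup>2"
proof -
  note nn = H1_term_nonneg[of p q, OF p q]
  have L2: "L2_set (\<lambda>n. sqrt (H1_term p q w n)) A = sqrt (\<Sum>n\<in>A. H1_term p q w n)" for w A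
    by (simp add: L2_set_def nn)
  have "L2_set (\<lambda>n. sqrt (H1_term p q (\<lambda>n. u n + v n) n)) {..<N} \<le>
      L2_set (\<lambda>n. sqrt (H1_term p q u n) + sqrt (H1_term p q v n)) {..<N}"
    by (intro L2_set_mono H1_term_add p q) (simp add: nn)
  also have "\<dots> \<le> L2_set (\<lambda>n. sqrt (H1_term p q u n)) {..<N} + L2_set (\<lambda>n. sqrt (H1_term p q v n)) {..<N}"
    by (rule L2_set_triangle_ineq)
  also have "\<dots> \<le> sqrt (suminf (H1_term p q u)) + sqrt (suminf (H1_term p q v))"
    unfolding L2 using u v
    by (intro add_mono real_sqrt_le_mono sum_le_suminf) (auto simp: mem_H1_iff nn)
  finally show ?thesis
    unfolding L2 by (rule sqrt_le_D)
qed

lemma H1_add: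
  assumes p: "\<And>n. 0 < p n" and q: "\<And>n. 0 \<le> q n" and u: "u \<in> H1 p q" and v: "v \<in> H1 p q"
  shows "(\<lambda>n. u n + v n) \<in> H1 p q"
  unfolding mem_H1_iff
proof (rule bounded_imp_summable)
  show "0 \<le> H1_term p q (\<lambda>n. u n + v n) n" for n
    by (rule H1_term_nonneg[OF p q])
  show "(\<Sum>k\<le>n. H1_term p q (\<lambda>n. u n + v n) k)
      \<le> (sqrt (suminf (H1_term p q u)) + sqrt (suminf (H1_term p q v)))\<^sup>2" for n
    using H1_partial_add[OF assms, where N = "Suc n"] by (simp only: lessThan_Suc_atMost)
qed

lemma H1_term_cmult: "H1_term p q (\<lambda>n. c * u n) n = (cmod c)\<^sup>2 * H1_term p q u n"
proof -
  have "fwd_diff (\<lambda>n. c * u n) n = c * fwd_diff u n"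
    by (simp add: fwd_diff_def right_diff_distrib)
  then show ?thesis
    by (simp add: H1_term_def norm_mult power_mult_distrib algebra_simps)
qed

lemma H1_cmult: "u \<in> H1 p q \<Longrightarrow> (\<lambda>n. c * u n) \<in> H1 p q"
  using summable_mult[of "H1_term p q u" "(cmod c)\<^sup>2"]
  unfolding mem_H1_iff H1_term_cmult[symmetric] by simp

lemma H1_diff:
  assumes "\<And>n. 0 < p n" "\<And>n. 0 \<le> q n" "u \<in> H1 p q" "v \<in> H1 p q"
  shows "(\<lambda>n. u n - v n) \<in> H1 p q"
  using H1_add[of p q u "\<lambda>n. - 1 * v n"] H1_cmult[of v p q "- 1"] assms by simp

lemma H1_inner_add_left:
  fixes p q :: "nat \<Rightarrow> real"
  assumes "\<And>n. 0 < p n" "\<And>n. 0 \<le> q n" "u \<in> H1 p q" "v \<in> H1 p q" "w \<in> H1 p q"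
  shows "H1_inner p q (\<lambda>n. u n + v n) w = H1_inner p q u w + H1_inner p q v w"
proof (rule sums_unique2[OF H1_inner_sums])
  show "(\<lambda>n. of_real (p n) * fwd_diff (\<lambda>n. u n + v n) n * cnj (fwd_diff w n) +
          of_real (q n) * (u n + v n) * cnj (w n)) sums (H1_inner p q u w + H1_inner p q v w)"
    using sums_add[OF H1_inner_sums[of p q u w] H1_inner_sums[of p q v w]] assms
    by (simp add: fwd_diff_def algebra_simps)
qed (use assms H1_add in auto)

lemma H1_inner_cmult_left:
  fixes p q :: "nat \<Rightarrow> real"
  assumes "\<And>n. 0 < p n" "\<And>n. 0 \<le> q n" "u \<in> H1 p q" "w \<in> H1 p q"
  shows "H1_inner p q (\<lambda>n. c * u n) w = c * H1_inner p q u w"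
proof (rule sums_unique2[OF H1_inner_sums])
  show "(\<lambda>n. of_real (p n) * fwd_diff (\<lambda>n. c * u n) n * cnj (fwd_diff w n) +
          of_real (q n) * (c * u n) * cnj (w n)) sums (c * H1_inner p q u w)"
    using sums_mult[OF H1_inner_sums[of p q u w], of c] assms
    by (simp add: fwd_diff_def algebra_simps)
qed (use assms H1_cmult in auto)

lemma H1_inner_self:
  fixes p q :: "nat \<Rightarrow> real"
  assumes "\<And>n. 0 < p n" "\<And>n. 0 \<le> q n" "u \<in> H1 p q"
  shows "H1_inner p q u u = of_real (suminf (H1_term p q u))"
proof -
  have "(\<lambda>n. complex_of_real (H1_term p q u n)) sums of_real (suminf (H1_term p q u))"
    using assms by (simp add: mem_H1_iff summable_sums sums_of_real)
  also have "(\<lambda>n. complex_of_real (H1_term p q u n)) =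
     (\<lambda>n. of_real (p n) * fwd_diff u n * cnj (fwd_diff u n) + of_real (q n) * u n * cnj (u n))"
    by (simp add: H1_term_def complex_norm_square mult.assoc del: of_real_power)
  finally show ?thesis
    unfolding H1_inner_def by (rule sums_unique[symmetric])
qed

lemma H1_norm_eq:
  fixes p q :: "nat \<Rightarrow> real"
  assumes "\<And>n. 0 < p n" "\<And>n. 0 \<le> q n" "u \<in> H1 p q"
  shows "H1_norm p q u = sqrt (suminf (H1_term p q u))"
  using suminf_nonneg[of "H1_term p q u"] assms
  by (simp add: H1_norm_def H1_inner_self H1_term_nonneg mem_H1_iff)

lemma H1_norm_triangle:
  assumes p: "\<And>n. 0 < p n" and q: "\<And>n. 0 \<le> q n" and u: "u \<in> H1 p q" and v: "v \<in> H1 p q"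
  shows "H1_norm p q (\<lambda>n. u n + v n) \<le> H1_norm p q u + H1_norm p q v"
proof -
  note nn = H1_term_nonneg[of p q, OF p q]
  have "suminf (H1_term p q (\<lambda>n. u n + v n)) \<le>
     (sqrt (suminf (H1_term p q u)) + sqrt (suminf (H1_term p q v)))\<^sup>2"
    using H1_partial_add[OF assms] H1_add[OF assms] by (intro suminf_le_const) (auto simp: mem_H1_iff)
  then have "sqrt (suminf (H1_term p q (\<lambda>n. u n + v n))) \<le>
     sqrt (suminf (H1_term p q u)) + sqrt (suminf (H1_term p q v))"
    using u v by (intro real_le_lsqrt add_nonneg_nonneg) (auto simp: mem_H1_iff nn suminf_nonneg)
  then show ?thesis
    using H1_add[OF assms] assms by (simp add: H1_norm_eq)
qed

lemma H1_norm_eq_0_iff: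
  fixes p q :: "nat \<Rightarrow> real"
  assumes p: "\<And>n. 0 < p n" and q: "\<And>n. 0 \<le> q n" and q0: "\<exists>n. q n \<noteq> 0" and u: "u \<in> H1 p q"
  shows "H1_norm p q u = 0 \<longleftrightarrow> u = (\<lambda>n. 0)"
proof
  note nn = H1_term_nonneg[of p q, OF p q]
  assume "H1_norm p q u = 0"
  then have t0: "\<forall>n. H1_term p q u n = 0"
    using suminf_eq_zero_iff[of "H1_term p q u"] nn u by (simp add: H1_norm_eq[OF p q u] mem_H1_iff)
  have z: "p n * (cmod (fwd_diff u n))\<^sup>2 = 0 \<and> q n * (cmod (u n))\<^sup>2 = 0" for n
    using t0[rule_format, of n] p[of n] q[of n]
    unfolding H1_term_def by (subst (asm) add_nonneg_eq_0_iff) simp_all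
  have step: "u (Suc n) = u n" for n
    using z[of n] p[of n] by (auto simp: fwd_diff_def)
  have "u n = u 0" for n
    by (induction n) (simp_all add: step)
  moreover obtain m where "q m \<noteq> 0" using q0 by blast
  then have "u m = 0" using z[of m] by auto
  ultimately show "u = (\<lambda>n. 0)" by metis
next
  assume "u = (\<lambda>n. 0)"
  then show "H1_norm p q u = 0"
    by (simp add: H1_norm_def H1_inner_def fwd_diff_def)
qed

lemma Metric_space_H1:
  fixes p q :: "nat \<Rightarrow> real"
  assumes p: "\<And>n. 0 < p n" and q: "\<And>n. 0 \<le> q n" and q0: "\<exists>n. q n \<noteq> 0"
  shows "Metric_space (H1 p q) (H1_dist p q)"
proof
  fix u v w
  show "0 \<le> H1_dist p q u v"
    by (simp add: H1_dist_def H1_norm_def)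
  show "H1_dist p q u v = H1_dist p q v u"
    by (simp add: H1_dist_def H1_norm_def H1_inner_def fwd_diff_def algebra_simps)
  assume u: "u \<in> H1 p q" and v: "v \<in> H1 p q"
  show "H1_dist p q u v = 0 \<longleftrightarrow> u = v"
    using H1_norm_eq_0_iff[OF p q q0 H1_diff[OF p q u v]]
    by (auto simp: H1_dist_def fun_eq_iff)
  assume w: "w \<in> H1 p q"
  show "H1_dist p q u w \<le> H1_dist p q u v + H1_dist p q v w"
    using H1_norm_triangle[OF p q H1_diff[OF p q u v] H1_diff[OF p q v w]]
    by (simp add: H1_dist_def)
qed

end

(*
  Evaluation at each point is bounded for the norm of H_1: sqrt (p n) bounds each increment, and a
  point m with q m > 0 anchors the value u m. Hence a Cauchy sequence converges pointwise, and
  Fatou's lemma for series turns pointwise convergence plus the Cauchy condition into convergence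
  in norm.
*)
theory Submission imports Defs begin

lemma H1_term_le_norm:
  fixes p q :: "nat \<Rightarrow> real"
  assumes p: "\<And>n. 0 < p n" and q: "\<And>n. 0 \<le> q n" and u: "u \<in> H1 p q"
  shows "H1_term p q u n \<le> (H1_norm p q u)\<^sup>2"
proof -
  note nn = H1_term_nonneg[of p q, OF p q]
  have "(\<Sum>k\<in>{n}. H1_term p q u k) \<le> suminf (H1_term p q u)"
    using u nn by (intro sum_le_suminf) (auto simp: mem_H1_iff)
  moreover have "0 \<le> suminf (H1_term p q u)"
    using u nn by (intro suminf_nonneg) (auto simp: mem_H1_iff)
  ultimately show ?thesis
    by (simp add: H1_norm_eq[OF p q u])
qed

text \<open>Telescoping from index 0: \<open>p k * (cmod (fwd_diff u k))\<^sup>2\<close> is part of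
  one term of the series for the squared norm, so the step from \<open>k\<close> to
  \<open>k + 1\<close> costs at most the norm divided by \<open>sqrt (p k)\<close>.\<close>

lemma H1_increment_bound:
  fixes p q :: "nat \<Rightarrow> real"
  assumes p: "\<And>n. 0 < p n" and q: "\<And>n. 0 \<le> q n" and u: "u \<in> H1 p q"
  shows "cmod (u n - u 0) \<le> (\<Sum>k<n. 1 / sqrt (p k)) * H1_norm p q u"
proof (induction n)
  case (Suc n)
  have "p n * (cmod (fwd_diff u n))\<^sup>2 \<le> H1_term p q u n"
    using q by (simp add: H1_term_def)
  then have "(sqrt (p n) * cmod (fwd_diff u n))\<^sup>2 \<le> (H1_norm p q u)\<^sup>2"
    using H1_term_le_norm[OF p q u, of n] p[of n] by (simp add: power_mult_distrib)
  then have "sqrt (p n) * cmod (fwd_diff u n) \<le> H1_norm p q u"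
    by (rule power2_le_imp_le) (simp add: H1_norm_def)
  then have "cmod (u (Suc n) - u n) \<le> 1 / sqrt (p n) * H1_norm p q u"
    using p[of n] by (simp add: fwd_diff_def field_simps)
  moreover have "cmod (u (Suc n) - u 0) \<le> cmod (u (Suc n) - u n) + cmod (u n - u 0)"
    using norm_triangle_ineq[of "u (Suc n) - u n" "u n - u 0"] by simp
  ultimately show ?case
    using Suc by (simp add: distrib_right)
qed simp

text \<open>Since \<open>q m > 0\<close> at some \<open>m\<close>, the norm controls
  \<open>u m\<close> itself and not only increments; walking from \<open>m\<close> to
  \<open>n\<close> then controls \<open>u n\<close>. The constant depends on \<open>n\<close> but
  not on \<open>u\<close>.\<close>

lemma H1_evaluation_bounded:
  fixes p q :: "nat \<Rightarrow> real"
  assumes p: "\<And>n. 0 < p n" and q: "\<And>n. 0 \<le> q n" and q0: "\<exists>n. q n \<noteq> 0"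
  shows "\<exists>C>0. \<forall>u\<in>H1 p q. cmod (u n) \<le> C * H1_norm p q u"
proof -
  obtain m where m: "0 < q m"
    using q q0 by (metis order_le_less)
  define S where "S n = (\<Sum>k<n. 1 / sqrt (p k))" for n
  have S: "0 \<le> S n" for n
    unfolding S_def using p by (intro sum_nonneg) (simp add: less_imp_le)
  show ?thesis
  proof (intro exI conjI ballI)
    \<comment> \<open>The three summands pay for the value at \<open>m\<close>, the way from
      \<open>m\<close> to 0 and the way from 0 to \<open>n\<close>.\<close>
    show "0 < 1 / sqrt (q m) + S m + S n"
      using m S[of m] S[of n] by (simp add: add_pos_nonneg)
  next
    fix u assume u: "u \<in> H1 p q"
    have "q m * (cmod (u m))\<^sup>2 \<le> H1_term p q u m"
      using p[of m] by (simp add: H1_term_def)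
    then have "(sqrt (q m) * cmod (u m))\<^sup>2 \<le> (H1_norm p q u)\<^sup>2"
      using H1_term_le_norm[OF p q u, of m] m by (simp add: power_mult_distrib)
    then have "sqrt (q m) * cmod (u m) \<le> H1_norm p q u"
      by (rule power2_le_imp_le) (simp add: H1_norm_def)
    then have "cmod (u m) \<le> 1 / sqrt (q m) * H1_norm p q u"
      using m by (simp add: field_simps)
    \<comment> \<open>The detour through index 0 avoids a case distinction between
      \<open>m \<le> n\<close> and \<open>n < m\<close>.\<close>
    moreover have "cmod (u n) \<le> cmod (u m) + cmod (u m - u 0) + cmod (u n - u 0)"
      by norm
    ultimately show "cmod (u n) \<le> (1 / sqrt (q m) + S m + S n) * H1_norm p q u"
      using H1_increment_bound[OF p q u, of m] H1_increment_bound[OF p q u, of n]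
      unfolding S_def distrib_right by linarith
  qed
qed

text \<open>A finite partial sum depends continuously on finitely many values, so the bound
  \<open>B\<^sup>2\<close> on it survives the pointwise limit; only afterwards does the length of
  the sum grow. Membership of the limit is thus a conclusion.\<close>

lemma H1_Fatou:
  fixes p q :: "nat \<Rightarrow> real"
  assumes p: "\<And>n. 0 < p n" and q: "\<And>n. 0 \<le> q n"
    and lim: "\<And>k. (\<lambda>j. f j k) \<longlonglongrightarrow> u k"
    and mem: "\<And>j. f j \<in> H1 p q"
    and bound: "\<forall>\<^sub>F j in sequentially. H1_norm p q (f j) \<le> B"
  shows "u \<in> H1 p q" "H1_norm p q u \<le> B"
proof -
  note nn = H1_term_nonneg[of p q, OF p q]
  \<comment> \<open>Norms are non-negative, so a single index below the bound shows
    \<open>0 \<le> B\<close>; this allows taking roots at the end.\<close>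
  obtain j where "H1_norm p q (f j) \<le> B"
    using eventually_happens[OF bound] by auto
  then have B: "0 \<le> B"
    by (rule order_trans[rotated]) (simp add: H1_norm_def)
  have partial: "(\<Sum>k<n. H1_term p q u k) \<le> B\<^sup>2" for n
  proof (rule tendsto_upperbound)
    show "(\<lambda>j. \<Sum>k<n. H1_term p q (f j) k) \<longlonglongrightarrow> (\<Sum>k<n. H1_term p q u k)"
      unfolding H1_term_def fwd_diff_def by (intro tendsto_intros lim)
    show "\<forall>\<^sub>F j in sequentially. (\<Sum>k<n. H1_term p q (f j) k) \<le> B\<^sup>2"
      using bound
    proof eventually_elim
      case (elim j)
      have "(\<Sum>k<n. H1_term p q (f j) k) \<le> suminf (H1_term p q (f j))"
        using mem[of j] nn by (intro sum_le_suminf) (auto simp: mem_H1_iff)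
      also have "\<dots> \<le> B\<^sup>2"
        using elim by (intro sqrt_le_D) (simp add: H1_norm_eq[OF p q mem])
      finally show ?case .
    qed
  qed simp
  \<comment> \<open>Membership comes before the norm bound, because \<open>H1_norm_eq\<close> holds
    for members only.\<close>
  show u: "u \<in> H1 p q"
    unfolding mem_H1_iff
  proof (rule bounded_imp_summable)
    show "0 \<le> H1_term p q u n" for n by (rule nn)
    show "(\<Sum>k\<le>n. H1_term p q u k) \<le> B\<^sup>2" for n
      using partial[of "Suc n"] by (simp only: lessThan_Suc_atMost)
  qed
  have "suminf (H1_term p q u) \<le> B\<^sup>2"
    using u partial by (intro suminf_le_const) (auto simp: mem_H1_iff)
  then show "H1_norm p q u \<le> B"
    using B by (simp add: H1_norm_eq[OF p q u] real_le_lsqrt)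
qed

theorem proposition2p5:
  fixes p q :: "nat \<Rightarrow> real"
  assumes "\<And>n. 0 < p n"
    and "\<And>n. 0 \<le> q n"
    and "\<exists>n. q n \<noteq> 0"
  shows "Metric_space.mcomplete (H1 p q) (H1_dist p q)"
proof -
  note p = assms(1) and q = assms(2) and q0 = assms(3)
  interpret Metric_space "H1 p q" "H1_dist p q"
    by (rule Metric_space_H1[OF assms])
  show ?thesis
    unfolding mcomplete_def
  proof (intro allI impI)
    fix \<sigma> assume "MCauchy \<sigma>"
    then have mem: "\<sigma> i \<in> H1 p q" for i
      by (auto simp: MCauchy_def)
    have cauchy: "\<exists>N. \<forall>i j. N \<le> i \<longrightarrow> N \<le> j \<longrightarrow> H1_norm p q (\<lambda>n. \<sigma> i n - \<sigma> j n) < e"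
      if "0 < e" for e
      using \<open>MCauchy \<sigma>\<close> that by (simp add: MCauchy_def H1_dist_def)
    have diff: "(\<lambda>n. \<sigma> i n - \<sigma> j n) \<in> H1 p q" for i j
      by (rule H1_diff[OF p q mem mem])
    have "convergent (\<lambda>i. \<sigma> i k)" for k
    proof -
      obtain C where C: "0 < C" "\<forall>u\<in>H1 p q. cmod (u k) \<le> C * H1_norm p q u"
        using H1_evaluation_bounded[of p q k, OF assms] by blast
      have "Cauchy (\<lambda>i. \<sigma> i k)"
      proof (rule CauchyI)
        fix e :: real assume "0 < e"
        then obtain N
          where N: "\<And>i j. N \<le> i \<Longrightarrow> N \<le> j \<Longrightarrow> H1_norm p q (\<lambda>n. \<sigma> i n - \<sigma> j n) < e / C"
          \<comment> \<open>The tolerance \<open>e / C\<close> compensates for the factor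
            \<open>C\<close> lost in evaluating at \<open>k\<close>.\<close>
          using cauchy[of "e / C"] divide_pos_pos[OF _ C(1)] by meson
        have "cmod (\<sigma> i k - \<sigma> j k) < e" if "N \<le> i" "N \<le> j" for i j
          using bspec[OF C(2) diff, of i j] N[OF that] C(1)
          by (simp add: pos_less_divide_eq mult.commute)
        then show "\<exists>N. \<forall>i\<ge>N. \<forall>j\<ge>N. cmod (\<sigma> i k - \<sigma> j k) < e"
          by blast
      qed
      then show ?thesis
        by (rule Cauchy_convergent)
    qed
    then obtain u where u: "(\<lambda>i. \<sigma> i k) \<longlonglongrightarrow> u k" for k
      unfolding convergent_def by metis
    \<comment> \<open>Freeze \<open>i\<close> and let \<open>j\<close> tend to infinity in the
      Cauchy condition; the strict bound weakens to \<open>\<le> e\<close>.\<close>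
    have tail: "\<exists>N. \<forall>i\<ge>N. (\<lambda>n. \<sigma> i n - u n) \<in> H1 p q \<and> H1_norm p q (\<lambda>n. \<sigma> i n - u n) \<le> e"
      if e: "0 < e" for e
    proof -
      obtain N where N: "\<And>i j. N \<le> i \<Longrightarrow> N \<le> j \<Longrightarrow> H1_norm p q (\<lambda>n. \<sigma> i n - \<sigma> j n) < e"
        using cauchy[OF e] by blast
      have "(\<lambda>n. \<sigma> i n - u n) \<in> H1 p q \<and> H1_norm p q (\<lambda>n. \<sigma> i n - u n) \<le> e" if "N \<le> i" for i
      proof -
        have lim: "(\<lambda>j. \<sigma> i k - \<sigma> j k) \<longlonglongrightarrow> \<sigma> i k - u k" for k
          by (intro tendsto_intros u)
        have ev: "\<forall>\<^sub>F j in sequentially. H1_norm p q (\<lambda>n. \<sigma> i n - \<sigma> j n) \<le> e"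
          using N[OF that] by (auto simp: eventually_sequentially intro: less_imp_le)
        show ?thesis
          using H1_Fatou[where f = "\<lambda>j n. \<sigma> i n - \<sigma> j n", OF p q lim diff ev] by blast
      qed
      then show ?thesis by blast
    qed
    obtain N where "(\<lambda>n. \<sigma> N n - u n) \<in> H1 p q"
      using tail[of 1] by auto
    \<comment> \<open>Here \<open>u\<close> is written as
      \<open>\<sigma> N - (\<sigma> N - u)\<close>, a difference of two members.\<close>
    then have "u \<in> H1 p q"
      using H1_diff[OF p q mem, of "\<lambda>n. \<sigma> N n - u n" N] by simp
    moreover have "\<exists>N. \<forall>i\<ge>N. \<sigma> i \<in> H1 p q \<and> H1_dist p q (\<sigma> i) u < e" if e: "0 < e" for e
    proof -
      \<comment> \<open>Halving \<open>e\<close> restores the strict inequality that metric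
        convergence demands.\<close>
      obtain N where "\<forall>i\<ge>N. H1_norm p q (\<lambda>n. \<sigma> i n - u n) \<le> e / 2"
        using tail[of "e / 2"] e by auto
      moreover have "e / 2 < e"
        using e by simp
      ultimately show ?thesis
        unfolding H1_dist_def using mem by (meson order_le_less_trans)
    qed
    ultimately show "\<exists>x. limitin mtopology \<sigma> x sequentially"
      by (auto simp: limit_metric_sequentially)
  qed
qed

end
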